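(* For every $s\in(0,1)$ there exists a minimizer of $\mathscr{W}_s$ in $X$, i.e. there is $\gamma\in X$ such that $\mathscr{W}_s(\gamma)\le \mathscr{W}_s(\tilde\gamma)$ for all $\tilde\gamma\in X$.
   Context: $\mathbb{S}^1$ is the unit circle, identified with $\mathbb{R}/2\pi\mathbb{Z}$; derivatives of maps on $\mathbb{S}^1$ are with respect to arclength. For $v=(v_1,v_2)\in\mathbb{R}^2$ put $v^\perp=(v_2,-v_1)$. A continuous $\gamma:\mathbb{S}^1\to\mathbb{R}^2$ is called convex in $\mathbb{S}^1$ if for every $x\in \mathbb{S}^1$ there is a unit vector $\nu_x\in\mathbb{R}^2$ with $\nu_x\cdot(\gamma(x)-\gamma(y))\ge 0$ for all $y\in\mathbb{S}^1$. $X$ is the set of all $\gamma\in C^1(\mathbb{S}^1,\mathbb{R}^2)$ such that $\gamma$ is a homeomorphism onto its image, $|\gamma'|\equiv 1$ on $\mathbb{S}^1$, and $\gamma$ is convex in $\mathbb{S}^1$. For $\gamma\in X$, with unit normal $n(\gamma(y)):=\gamma'(y)^\perp$, $$\mathscr{W}_s(\gamma)=\int_{\mathbb{S}^1}\left|\int_{\mathbb{S}^1}\frac{\langle n(\gamma(y)),\gamma(y)-\gamma(x)\rangle}{|\gamma(y)-\gamma(x)|^{2+s}}\,|\gamma'(y)|\,dy\right|^{\frac1s}|\gamma'(x)|\,dx\in[0,+\infty].$$ For $\gamma\in X$ the inner integrand has a constant sign (depending on the orientation of $\gamma$), so the inner integral is well defined in $[-\infty,+\infty]$. *)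

theory Defs
  imports "HOL-Analysis.Analysis"
begin

definition perp :: "real^2 \<Rightarrow> real^2" where
  "perp v = vector [v $ 2, - (v $ 1)]"

text \<open>Maps on the unit circle are functions on \<^typ>\<open>complex\<close> of which only the values on
  \<^term>\<open>sphere 0 1 :: complex set\<close> matter.  The point with arclength coordinate \<open>t\<close> is
  \<^term>\<open>cis t\<close>, which realises the identification of the circle with the reals
  modulo \<open>2\<pi>\<close>.\<close>

definition lift :: "(complex \<Rightarrow> real^2) \<Rightarrow> real \<Rightarrow> real^2" where
  "lift \<gamma> t = \<gamma> (cis t)"

definition arc_deriv :: "(complex \<Rightarrow> real^2) \<Rightarrow> real \<Rightarrow> real^2" where
  "arc_deriv \<gamma> t = vector_derivative (lift \<gamma>) (at t)"

definition arc_measure :: "real measure" where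
  "arc_measure = restrict_space lborel {0..2*pi}"

definition convex_curve :: "(complex \<Rightarrow> real^2) \<Rightarrow> bool" where
  "convex_curve \<gamma> \<longleftrightarrow>
     (\<forall>x\<in>sphere 0 1. \<exists>\<nu>. norm \<nu> = 1 \<and> (\<forall>y\<in>sphere 0 1. \<nu> \<bullet> (\<gamma> x - \<gamma> y) \<ge> 0))"

definition X :: "(complex \<Rightarrow> real^2) set" where
  "X = {\<gamma>. lift \<gamma> C1_differentiable_on UNIV
          \<and> (\<exists>g. homeomorphism (sphere 0 1) (\<gamma> ` sphere 0 1) \<gamma> g)
          \<and> (\<forall>t. norm (arc_deriv \<gamma> t) = 1)
          \<and> convex_curve \<gamma>}"

text \<open>The integral with values in the extended reals, positive part minus negative part
  (\<^const>\<open>ennreal\<close> maps negative numbers to \<open>0\<close>).  It is meaningful only when one of the two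
  parts has a finite integral, as is the case for integrands of constant sign.\<close>

definition ext_integral :: "'a measure \<Rightarrow> ('a \<Rightarrow> real) \<Rightarrow> ereal" where
  "ext_integral M f =
     enn2ereal (\<integral>\<^sup>+ x. ennreal (f x) \<partial>M) - enn2ereal (\<integral>\<^sup>+ x. ennreal (- f x) \<partial>M)"

definition enn_powr :: "ennreal \<Rightarrow> real \<Rightarrow> ennreal" where
  "enn_powr a p = (if a = \<infinity> then \<infinity> else ennreal (enn2real a powr p))"

text \<open>Here \<open>n(\<gamma>(y)) = perp (\<gamma>'(y))\<close>.  On the diagonal the integrand is \<open>0\<close> by the
  convention on division by zero; for fixed \<open>x\<close> this concerns a null set of \<open>y\<close>.\<close>

definition nonlocal_curvature :: "real \<Rightarrow> (complex \<Rightarrow> real^2) \<Rightarrow> real \<Rightarrow> ereal" where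
  "nonlocal_curvature s \<gamma> x =
     ext_integral arc_measure
       (\<lambda>y. (perp (arc_deriv \<gamma> y) \<bullet> (lift \<gamma> y - lift \<gamma> x))
              / norm (lift \<gamma> y - lift \<gamma> x) powr (2 + s) * norm (arc_deriv \<gamma> y))"

definition W :: "real \<Rightarrow> (complex \<Rightarrow> real^2) \<Rightarrow> ennreal" where
  "W s \<gamma> =
     (\<integral>\<^sup>+ x. enn_powr (e2ennreal \<bar>nonlocal_curvature s \<gamma> x\<bar>) (1 / s)
               * ennreal (norm (arc_deriv \<gamma> x)) \<partial>arc_measure)"

end

theory Submission
  imports Defs
begin

text \<open>The unit circle is a minimizer.  Write a positively oriented competitor as a complex curve
  \<open>z\<close>, and for a fixed arclength gap \<open>u\<close> put \<open>c(t) = z(t + u) - z(t)\<close>, \<open>r = |c|\<close>, \<open>q = Im (c'/c)\<close> and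
  \<open>w = 2 sin (u/2)\<close>, the chord length of the circle.  Symmetrizing the curvature integrand in its two
  arguments gives \<open>q r\<^sup>-\<^sup>s\<close>, and convexity of \<open>r\<^sup>-\<^sup>s\<close> yields
  \<open>q r\<^sup>-\<^sup>s \<ge> (1 + s) w\<^sup>-\<^sup>s q - s w\<^sup>-\<^sup>s\<^sup>-\<^sup>1 q r\<close>.  The integral of \<open>q\<close> over \<open>t\<close> is \<open>2\<pi>\<close>, because \<open>c\<close> winds once
  around the origin.  Moreover \<open>q r \<le> |c'| = 2 sin ((\<tau>(t + u) - \<tau>(t))/2)\<close> for the tangent angle \<open>\<tau>\<close>,
  whose increments over a gap \<open>u\<close> have mean \<open>u\<close>, so concavity of the sine bounds the mean of \<open>q r\<close> by \<open>w\<close>.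
  Hence every gap contributes at least as much as for the circle, that is, the circle minimizes
  the integral of the nonlocal curvature, and since its curvature is constant, Jensen's inequality
  for the power \<open>1/s\<close> concludes.\<close>

section \<open>Auxiliary facts on the sine, continuous angles and periodic integrands\<close>

lemma sin_le_tangent:
  fixes x y :: real
  assumes "0 \<le> x" "x \<le> pi" "0 < y" "y < pi"
  shows "sin x \<le> sin y + cos y * (x - y)"
proof -
  have conv: "convex_on {0..pi} (\<lambda>t::real. - sin t)"
    by (rule f''_ge0_imp_convex[where f' = "\<lambda>t. - cos t" and f'' = sin])
      (auto intro!: derivative_eq_intros sin_ge_zero)
  have "- sin x - (- sin y) \<ge> - cos y * (x - y)"
    using assms
    by (intro convex_on_imp_above_tangent[OF conv])
      (auto intro!: derivative_eq_intros simp: interior_atLeastAtMost_real)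
  then show ?thesis by simp
qed

text \<open>Reals with the same \<open>cis\<close> differ by a multiple of \<open>2 * pi\<close>, so
  distinct values of \<open>f\<close> are at least \<open>2 * pi\<close> apart; a continuous
  function with such a range on a connected set is constant.\<close>

lemma constant_on_if_cis_constant:
  fixes f :: "real \<Rightarrow> real"
  assumes "connected S" "continuous_on S f" and const: "\<And>t. t \<in> S \<Longrightarrow> cis (f t) = c"
  shows "f constant_on S"
proof (rule continuous_discrete_range_constant[OF assms(1,2)])
  fix x assume x: "x \<in> S"
  have "2 * pi \<le> norm (f y - f x)" if "y \<in> S" "f y \<noteq> f x" for y
  proof -
    have "cis (f y) = cis (f x)" using const x that by simp
    then have "exp (\<i> * of_real (f y)) = exp (\<i> * of_real (f x))" by (simp add: cis_conv_exp)
    then obtain n :: int where n: "\<i> * of_real (f y) = \<i> * of_real (f x) + of_int (2 * n) * pi * \<i>"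
      unfolding exp_eq by blast
    then have eq: "f y = f x + 2 * n * pi"
      by (auto simp: complex_eq_iff)
    then have "n \<noteq> 0" using that by auto
    then have "1 \<le> \<bar>real_of_int n\<bar>" by linarith
    then show ?thesis using eq pi_gt_zero by (simp add: abs_mult)
  qed
  then show "\<exists>e>0. \<forall>y. y \<in> S \<and> f y \<noteq> f x \<longrightarrow> e \<le> norm (f y - f x)"
    using pi_gt_zero by (intro exI[of _ "2*pi"]) auto
qed

text \<open>With \<open>P\<close> a primitive of \<open>c' / c\<close>, the product
  \<open>c t * exp (- P t)\<close> has derivative zero. Hence \<open>\<phi> t - Im (P t)\<close> has
  constant \<open>cis\<close> and is itself constant, so the increment of \<open>\<phi>\<close> is
  that of \<open>Im P\<close>.\<close>

lemma has_integral_angular_velocity: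
  fixes c c' :: "real \<Rightarrow> complex" and \<phi> :: "real \<Rightarrow> real"
  assumes "a \<le> b"
    and deriv: "\<And>t. (c has_vector_derivative c' t) (at t)"
    and cont': "continuous_on UNIV c'"
    and nz: "\<And>t. c t \<noteq> 0"
    and cont: "continuous_on UNIV \<phi>"
    and polar: "\<And>t. c t = of_real (norm (c t)) * cis (\<phi> t)"
  shows "((\<lambda>t. Im (c' t / c t)) has_integral \<phi> b - \<phi> a) {a..b}"
proof -
  have contc: "continuous_on UNIV c"
    using deriv by (auto intro!: continuous_at_imp_continuous_on has_vector_derivative_continuous)
  define q where "q = (\<lambda>t. c' t / c t)"
  have contq: "continuous_on A q" for A
    unfolding q_def using nz
    by (intro continuous_intros continuous_on_subset[OF contc] continuous_on_subset[OF cont']) auto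
  define P where "P = (\<lambda>t. integral {a..t} q)"
  have P: "(P has_vector_derivative q t) (at t within {a..b})" if "t \<in> {a..b}" for t
    unfolding P_def by (rule integral_has_vector_derivative[OF contq that])
  have const: "\<exists>k. \<forall>t\<in>{a..b}. c t * exp (- P t) = k"
  proof -
    have "((\<lambda>t. c t * exp (- P t)) has_derivative (\<lambda>h. 0)) (at t within {a..b})"
      if t: "t \<in> {a..b}" for t
    proof -
      have "((\<lambda>t. exp (- P t)) has_vector_derivative (- q t) * exp (- P t)) (at t within {a..b})"
        using field_vector_diff_chain_within[of "\<lambda>t. - P t" "- q t" t "{a..b}" exp "exp (- P t)"]
          has_vector_derivative_minus[OF P[OF t]]
        by (simp add: o_def DERIV_exp has_field_derivative_at_within)
      from has_vector_derivative_mult[OF has_vector_derivative_at_within[OF deriv] this]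
      have "((\<lambda>t. c t * exp (- P t)) has_vector_derivative
              c t * (- q t * exp (- P t)) + c' t * exp (- P t)) (at t within {a..b})" .
      moreover have "c t * (- q t * exp (- P t)) + c' t * exp (- P t) = 0"
        using nz[of t] by (simp add: q_def field_simps)
      ultimately show ?thesis by (simp add: has_vector_derivative_def)
    qed
    from has_derivative_zero_constant[OF convex_real_interval(5) this] show ?thesis by blast
  qed
  then obtain k where k: "\<And>t. t \<in> {a..b} \<Longrightarrow> c t * exp (- P t) = k" by blast
  have cis_eq: "cis (\<phi> t - Im (P t)) = sgn k" if t: "t \<in> {a..b}" for t
  proof -
    have e: "exp (- P t) = of_real (exp (- Re (P t))) * cis (- Im (P t))"
      by (simp add: exp_eq_polar)
    have "k = of_real (norm (c t)) * cis (\<phi> t) * exp (- P t)"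
      using k[OF t] polar[of t] by metis
    also have "\<dots> = of_real (norm (c t) * exp (- Re (P t))) * cis (\<phi> t - Im (P t))"
    proof -
      have "cis (\<phi> t - Im (P t)) = cis (\<phi> t) * cis (- Im (P t))" by (simp add: cis_mult)
      then show ?thesis by (simp add: e)
    qed
    finally have k': "k = of_real (norm (c t) * exp (- Re (P t))) * cis (\<phi> t - Im (P t))" .
    have "norm (c t) * exp (- Re (P t)) > 0" using nz[of t] by simp
    then show ?thesis using nz[of t] by (subst k') (simp add: sgn_eq norm_mult)
  qed
  have contP: "continuous_on {a..b} P"
    unfolding continuous_on_eq_continuous_within using P has_vector_derivative_continuous by blast
  have "(\<lambda>t. \<phi> t - Im (P t)) constant_on {a..b}"
    by (rule constant_on_if_cis_constant[OF _ _ cis_eq])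
      (auto intro!: continuous_intros contP continuous_on_subset[OF cont])
  then have "\<phi> b - Im (P b) = \<phi> a - Im (P a)"
    using \<open>a \<le> b\<close> by (force simp: constant_on_def)
  then have eq: "\<phi> b - \<phi> a = Im (integral {a..b} q)"
    by (simp add: P_def)
  have "(q has_integral integral {a..b} q) {a..b}"
    by (intro integrable_integral integrable_continuous_interval contq)
  from has_integral_Im[OF this] show ?thesis by (simp add: eq q_def)
qed

text \<open>The shifted window \<open>{t..p+t}\<close> is cut at \<open>p\<close>, and the piece
  beyond \<open>p\<close> is moved back by one period; the pieces then fill \<open>{0..p}\<close> up
  to single points.\<close>

lemma nn_integral_periodic_shift:
  fixes f :: "real \<Rightarrow> ennreal"
  assumes [measurable]: "f \<in> borel_measurable borel"
    and per: "\<And>x. f (x + p) = f x" and "0 \<le> t" "t \<le> p"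
  shows "(\<integral>\<^sup>+x. f (x + t) * indicator {0..p} x \<partial>lborel) = (\<integral>\<^sup>+x. f x * indicator {0..p} x \<partial>lborel)"
proof -
  have "(\<integral>\<^sup>+x. f (x + t) * indicator {0..p} x \<partial>lborel) = (\<integral>\<^sup>+x. f x * indicator {t..p+t} x \<partial>lborel)"
    by (subst nn_integral_real_affine[where c = 1 and t = t])
      (auto intro!: nn_integral_cong simp: add.commute indicator_def)
  also have "\<dots> = (\<integral>\<^sup>+x. f x * indicator {t..<p} x + f x * indicator {p..p+t} x \<partial>lborel)"
    using assms(3,4) by (auto intro!: nn_integral_cong simp: indicator_def)
  also have "\<dots> = (\<integral>\<^sup>+x. f x * indicator {t..<p} x \<partial>lborel) + (\<integral>\<^sup>+x. f x * indicator {p..p+t} x \<partial>lborel)"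
    by (rule nn_integral_add) auto
  also have "(\<integral>\<^sup>+x. f x * indicator {p..p+t} x \<partial>lborel) = (\<integral>\<^sup>+x. f x * indicator {0..t} x \<partial>lborel)"
    by (subst nn_integral_real_affine[where c = 1 and t = p])
      (auto intro!: nn_integral_cong simp: add.commute[of p] per indicator_def)
  also have "(\<integral>\<^sup>+x. f x * indicator {t..<p} x \<partial>lborel) + (\<integral>\<^sup>+x. f x * indicator {0..t} x \<partial>lborel)
      = (\<integral>\<^sup>+x. f x * indicator {t..<p} x + f x * indicator {0..t} x \<partial>lborel)"
    by (rule nn_integral_add[symmetric]) auto
  also have "\<dots> = (\<integral>\<^sup>+x. f x * indicator {0..p} x \<partial>lborel)"
    using AE_lborel_singleton[of t] AE_lborel_singleton[of p] assms(3,4)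
    by (intro nn_integral_cong_AE) (auto simp: indicator_def)
  finally show ?thesis .
qed

section \<open>Convex closed curves in the complex plane\<close>

text \<open>\<open>Im (cnj v * w)\<close> is the cross product of \<open>v\<close> and
  \<open>w\<close>, so \<open>convex\<close> says that the loop stays to the left of each of its
  tangents, i.e. runs counterclockwise.\<close>

locale convex_loop =
  fixes z z' :: "real \<Rightarrow> complex"
  assumes deriv: "(z has_vector_derivative z' t) (at t)"
    and cont': "continuous_on UNIV z'"
    and periodic: "z (t + 2 * pi) = z t" and periodic': "z' (t + 2 * pi) = z' t"
    and speed: "norm (z' t) = 1"
    and simple: "0 < u \<Longrightarrow> u < 2 * pi \<Longrightarrow> z (t + u) \<noteq> z t"
    and convex: "0 \<le> Im (cnj (z' a) * (z b - z a))"
begin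

lemma continuous_curve: "continuous_on A z"
  using deriv by (auto intro!: continuous_at_imp_continuous_on has_vector_derivative_continuous)

lemma continuous_deriv: "continuous_on A z'"
  by (rule continuous_on_subset[OF cont']) auto

lemma deriv_nonzero: "z' t \<noteq> 0"
  using speed[of t] by auto

lemma simple_less: "a < b \<Longrightarrow> b < a + 2 * pi \<Longrightarrow> z b \<noteq> z a"
  using simple[of "b - a" a] by simp

text \<open>Dividing by the inward normal \<open>\<i> * z' a\<close> turns that normal into the
  positive real axis, which keeps every nonzero chord off the branch cut of
  \<open>Ln\<close>.\<close>

definition dir :: "real \<Rightarrow> real \<Rightarrow> complex" where
  "dir a b = (z b - z a) / (\<i> * z' a)"

text \<open>The angle from the tangent at \<open>a\<close> to the chord towards \<open>z b\<close>.  By convexity \<open>dir a b\<close> lies in the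
  closed right half plane, where the principal logarithm is continuous away from the origin.\<close>

definition chord_angle :: "real \<Rightarrow> real \<Rightarrow> real" where
  "chord_angle a b = pi / 2 + Im (Ln (dir a b))"

lemma Re_dir: "0 \<le> Re (dir a b)"
proof -
  have "inverse (z' a) = cnj (z' a)"
    using speed[of a] by (metis complex_norm_square inverse_unique mult.commute of_real_1 power_one)
  then have "dir a b = - \<i> * (cnj (z' a) * (z b - z a))"
    by (simp add: dir_def divide_inverse)
  then show ?thesis using convex[of a b] by simp
qed

lemma cis_chord_angle:
  assumes "z b \<noteq> z a"
  shows "cis (chord_angle a b) = sgn ((z b - z a) / z' a)"
proof -
  have nz: "dir a b \<noteq> 0" using assms deriv_nonzero by (simp add: dir_def)
  have "sgn (dir a b) = cis (Im (Ln (dir a b)))"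
    using nz by (metis exp_Ln exp_eq_polar sgn_mult sgn_cis sgn_of_real sgn_pos exp_gt_zero of_real_1 mult_1)
  then have "cis (chord_angle a b) = \<i> * sgn (dir a b)"
    by (simp add: chord_angle_def cis_mult[symmetric])
  also have "\<dots> = sgn (\<i> * dir a b)" by (simp add: sgn_mult) (simp add: sgn_eq)
  also have "\<i> * dir a b = (z b - z a) / z' a" by (simp add: dir_def)
  finally show ?thesis .
qed

lemma chord_angle_bounds:
  assumes "z b \<noteq> z a"
  shows "0 \<le> chord_angle a b" "chord_angle a b \<le> pi"
proof -
  have "dir a b \<noteq> 0" using assms deriv_nonzero by (simp add: dir_def)
  then have "\<bar>Im (Ln (dir a b))\<bar> \<le> pi / 2" using Re_Ln_pos_le Re_dir by blast
  then show "0 \<le> chord_angle a b" "chord_angle a b \<le> pi"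
    unfolding chord_angle_def by linarith+
qed

lemma dir_not_nonpos: "z b \<noteq> z a \<Longrightarrow> dir a b \<notin> \<real>\<^sub>\<le>\<^sub>0"
proof
  assume "z b \<noteq> z a" "dir a b \<in> \<real>\<^sub>\<le>\<^sub>0"
  then have "dir a b = 0"
    using Re_dir[of a b] by (simp add: complex_nonpos_Reals_iff complex_eq_iff)
  then show False using \<open>z b \<noteq> z a\<close> deriv_nonzero by (simp add: dir_def)
qed

end

section \<open>Limits of the chord directions and the tangent angle\<close>

lemma tendsto_difference_quotient:
  fixes f :: "real \<Rightarrow> 'a::real_normed_vector"
  assumes "(f has_vector_derivative f') (at m)"
  shows "((\<lambda>b. (f b - f m) /\<^sub>R (b - m)) \<longlongrightarrow> f') (at m)"
proof -
  have "((\<lambda>b. norm (f b - f m - (b - m) *\<^sub>R f') / norm (b - m)) \<longlongrightarrow> 0) (at m)"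
    using assms by (simp add: has_vector_derivative_def has_derivative_iff_norm)
  then have "((\<lambda>b. norm ((f b - f m) /\<^sub>R (b - m) - f')) \<longlongrightarrow> 0) (at m)"
  proof (rule Lim_transform_eventually)
    show "\<forall>\<^sub>F b in at m. norm (f b - f m - (b - m) *\<^sub>R f') / norm (b - m) =
        norm ((f b - f m) /\<^sub>R (b - m) - f')"
    proof (rule eventually_at_filter[THEN iffD2], rule always_eventually, intro allI impI)
      fix b assume b: "b \<noteq> m"
      then have "(f b - f m) /\<^sub>R (b - m) - f' = (f b - f m - (b - m) *\<^sub>R f') /\<^sub>R (b - m)"
        by (simp add: scaleR_diff_right)
      then show "norm (f b - f m - (b - m) *\<^sub>R f') / norm (b - m) =
          norm ((f b - f m) /\<^sub>R (b - m) - f')" by (simp add: divide_inverse_commute)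
    qed
  qed
  then show ?thesis by (simp add: tendsto_norm_zero_iff LIM_zero_iff)
qed

text \<open>Allows \<open>dir\<close>, which tends to zero at short gaps, to be rescaled to a
  convergent quotient without changing its argument.\<close>

lemma Im_Ln_scaleR:
  assumes "0 < r" "w \<noteq> 0"
  shows "Im (Ln (r *\<^sub>R w)) = Im (Ln w)"
proof -
  have "Ln (of_real r * w) = Ln (of_real r) + Ln w"
    using assms mpi_less_Im_Ln[of w] Im_Ln_le_pi[of w] by (intro Ln_times_simple) (auto simp: Ln_of_real)
  then show ?thesis using assms by (simp add: scaleR_conv_of_real Ln_of_real)
qed

context convex_loop
begin

text \<open>The sum of the angles that the chord makes with the two tangents at its ends; it is the
  increment of the tangent angle when \<open>a < b < a + 2\<pi>\<close>.\<close>

definition turning :: "real \<Rightarrow> real \<Rightarrow> real" where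
  "turning a b = chord_angle a b + pi - chord_angle b a"

lemma turning_bounds:
  assumes "z b \<noteq> z a"
  shows "0 \<le> turning a b" "turning a b \<le> 2 * pi"
  using chord_angle_bounds[of a b] chord_angle_bounds[of b a] assms
  unfolding turning_def by fastforce+

text \<open>The two chords are opposite to each other; the \<open>pi\<close> in
  \<open>turning\<close> absorbs this sign, so the chord cancels and only the tangents
  remain.\<close>

lemma cis_turning:
  assumes "z b \<noteq> z a"
  shows "cis (turning a b) = z' b / z' a"
proof -
  have "cis (turning a b) = - (cis (chord_angle a b) / cis (chord_angle b a))"
    by (simp add: turning_def cis_divide[symmetric] cis_mult[symmetric])
  also have "\<dots> = - (sgn ((z b - z a) / z' a) / sgn ((z a - z b) / z' b))"
    using assms cis_chord_angle[of a b] cis_chord_angle[of b a] by auto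
  also have "\<dots> = z' b / z' a"
    using assms deriv_nonzero[of a] deriv_nonzero[of b]
    by (simp add: sgn_eq norm_divide speed norm_minus_commute field_simps)
  finally show ?thesis .
qed

lemma tendsto_deriv: "(z' \<longlongrightarrow> z' m) (at m within S)"
  using continuous_deriv[of UNIV] tendsto_within_subset
  by (metis UNIV_I continuous_on subset_UNIV)

text \<open>At short gaps the chord is nearly \<open>b - m\<close> times the tangent, and the
  tangent divided by the inward normal is \<open>- \<i>\<close>; the reversed chord has the opposite
  sign.\<close>

lemma tendsto_dirs:
  "((\<lambda>b. dir m b /\<^sub>R (b - m)) \<longlongrightarrow> - \<i>) (at m)"
  "((\<lambda>b. dir b m /\<^sub>R (b - m)) \<longlongrightarrow> \<i>) (at m)"
proof -
  have "((\<lambda>b. (z b - z m) /\<^sub>R (b - m) / (\<i> * z' m)) \<longlongrightarrow> z' m / (\<i> * z' m)) (at m)"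
    by (intro tendsto_intros tendsto_difference_quotient deriv) (simp add: deriv_nonzero)
  moreover have "(z b - z m) /\<^sub>R (b - m) / (\<i> * z' m) = dir m b /\<^sub>R (b - m)" for b
    by (simp add: dir_def divide_inverse scaleR_conv_of_real)
  moreover have "z' m / (\<i> * z' m) = - \<i>" using deriv_nonzero[of m] by simp
  ultimately show "((\<lambda>b. dir m b /\<^sub>R (b - m)) \<longlongrightarrow> - \<i>) (at m)" by simp
  have "((\<lambda>b. - ((z b - z m) /\<^sub>R (b - m)) / (\<i> * z' b)) \<longlongrightarrow> - z' m / (\<i> * z' m)) (at m)"
    by (intro tendsto_intros tendsto_difference_quotient deriv tendsto_deriv) (simp add: deriv_nonzero)
  moreover have "- ((z b - z m) /\<^sub>R (b - m)) / (\<i> * z' b) = dir b m /\<^sub>R (b - m)" for b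
    by (simp add: dir_def divide_inverse scaleR_conv_of_real algebra_simps)
  moreover have "- z' m / (\<i> * z' m) = \<i>" using deriv_nonzero[of m] by simp
  ultimately show "((\<lambda>b. dir b m /\<^sub>R (b - m)) \<longlongrightarrow> \<i>) (at m)" by simp
qed

lemma not_nonpos_units: "\<i> \<notin> \<real>\<^sub>\<le>\<^sub>0" "- \<i> \<notin> \<real>\<^sub>\<le>\<^sub>0"
  by (simp_all add: complex_nonpos_Reals_iff)

lemma Im_Ln_dir_pos:
  assumes "z b \<noteq> z a" "0 < r"
  shows "Im (Ln (dir a b /\<^sub>R r)) = Im (Ln (dir a b))"
  using assms deriv_nonzero[of a] by (intro Im_Ln_scaleR) (auto simp: dir_def)

text \<open>Just after \<open>m\<close> the directions point along \<open>- \<i>\<close> and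
  \<open>\<i>\<close>, so the limit is \<open>pi - pi / 2 - pi / 2\<close>.\<close>

lemma turning_at_right: "(turning m \<longlongrightarrow> 0) (at_right m)"
proof -
  have "((\<lambda>b. pi + Im (Ln (dir m b /\<^sub>R (b - m))) - Im (Ln (dir b m /\<^sub>R (b - m))))
      \<longlongrightarrow> pi + Im (Ln (- \<i>)) - Im (Ln \<i>)) (at_right m)"
    by (intro tendsto_intros tendsto_dirs[THEN filterlim_mono] order_refl at_le not_nonpos_units) auto
  then have "((\<lambda>b. pi + Im (Ln (dir m b /\<^sub>R (b - m))) - Im (Ln (dir b m /\<^sub>R (b - m)))) \<longlongrightarrow> 0) (at_right m)"
    by simp
  then show ?thesis
  proof (rule Lim_transform_eventually)
    have "\<forall>\<^sub>F b in at_right m. b \<in> {m<..<m + 2 * pi}"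
      by (rule eventually_at_right_real) simp
    then show "\<forall>\<^sub>F b in at_right m.
        pi + Im (Ln (dir m b /\<^sub>R (b - m))) - Im (Ln (dir b m /\<^sub>R (b - m))) = turning m b"
    proof eventually_elim
      case (elim b)
      then have "z b \<noteq> z m" by (intro simple_less) auto
      then show ?case using elim
        by (subst (1 2) Im_Ln_dir_pos) (auto simp: turning_def chord_angle_def)
    qed
  qed
qed

text \<open>Just before \<open>m\<close> the factor \<open>b - m\<close> is negative, so the
  quotients are negated to make the scaling positive. This exchanges the limiting directions, and
  the limit becomes \<open>pi + pi / 2 + pi / 2\<close>.\<close>

lemma turning_at_left: "(turning m \<longlongrightarrow> 2 * pi) (at_left m)"
proof -
  have "((\<lambda>b. pi + Im (Ln (- (dir m b /\<^sub>R (b - m)))) - Im (Ln (- (dir b m /\<^sub>R (b - m)))))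
      \<longlongrightarrow> pi + Im (Ln (- (- \<i>))) - Im (Ln (- \<i>))) (at_left m)"
    by (intro tendsto_intros tendsto_dirs[THEN filterlim_mono] order_refl at_le) 
       (auto simp: complex_nonpos_Reals_iff)
  then have "((\<lambda>b. pi + Im (Ln (- (dir m b /\<^sub>R (b - m)))) - Im (Ln (- (dir b m /\<^sub>R (b - m))))) \<longlongrightarrow> 2 * pi) (at_left m)"
    by simp
  then show ?thesis
  proof (rule Lim_transform_eventually)
    have "\<forall>\<^sub>F b in at_left m. b \<in> {m - 2 * pi<..<m}"
      by (rule eventually_at_left_real) simp
    then show "\<forall>\<^sub>F b in at_left m.
        pi + Im (Ln (- (dir m b /\<^sub>R (b - m)))) - Im (Ln (- (dir b m /\<^sub>R (b - m)))) = turning m b"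
    proof eventually_elim
      case (elim b)
      then have nz: "z m \<noteq> z b" by (intro simple_less) auto
      have "- (w /\<^sub>R (b - m)) = w /\<^sub>R (m - b)" for w :: complex
        by (metis minus_diff_eq inverse_minus_eq scaleR_minus_left)
      then show ?case using elim nz
        by (simp add: Im_Ln_dir_pos turning_def chord_angle_def)
    qed
  qed
qed

lemma turning_periodic: "turning (a + 2 * pi) b = turning a b"
  by (simp add: turning_def chord_angle_def dir_def periodic periodic')

lemma continuous_on_chord_angle:
  assumes "continuous_on S f" "continuous_on S g" "\<And>t. t \<in> S \<Longrightarrow> z (g t) \<noteq> z (f t)"
  shows "continuous_on S (\<lambda>t. chord_angle (f t) (g t))"
proof -
  have "continuous_on S (\<lambda>t. dir (f t) (g t))"
    unfolding dir_def using assms(1,2)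
    by (intro continuous_intros continuous_on_compose2[OF continuous_curve[of UNIV]]
        continuous_on_compose2[OF continuous_deriv[of UNIV]]) (simp_all add: deriv_nonzero)
  then show ?thesis
    unfolding chord_angle_def by (intro continuous_intros) (simp_all add: assms(3) dir_not_nonpos)
qed

text \<open>A continuous logarithm of \<open>z'\<close> supplies \<open>\<tau>\<close>. On the open
  period after \<open>a\<close>, \<open>turning a b - \<tau> b\<close> has constant
  \<open>cis\<close> and so is constant; the limits \<open>0\<close> and \<open>2 * pi\<close> of
  \<open>turning\<close> at the two ends show that \<open>turning\<close> is the increment of
  \<open>\<tau>\<close> and that the loop turns exactly once. The last claim is then
  \<open>turning_bounds\<close>.\<close>

lemma tangent_angle:
  obtains \<tau> where "continuous_on UNIV \<tau>" "\<And>t. z' t = cis (\<tau> t)"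
    "\<And>t. \<tau> (t + 2 * pi) = \<tau> t + 2 * pi"
    "\<And>t u. 0 < u \<Longrightarrow> u < 2 * pi \<Longrightarrow> 0 \<le> \<tau> (t + u) - \<tau> t \<and> \<tau> (t + u) - \<tau> t \<le> 2 * pi"
proof -
  obtain g where g: "continuous_on UNIV g" "\<And>t. z' t = exp (g t)"
    by (rule continuous_logarithm_on_contractible[OF cont' contractible_UNIV deriv_nonzero]) simp
  define \<tau> where "\<tau> = (\<lambda>t. Im (g t))"
  have cont: "continuous_on UNIV \<tau>" unfolding \<tau>_def by (intro continuous_intros g)
  have "norm (exp (g t)) = 1" for t using speed[of t] g(2) by simp
  then have zcis: "z' t = cis (\<tau> t)" for t
    using g(2)[of t] exp_eq_polar[of "g t"] by (simp add: \<tau>_def)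
  have key: "\<tau> (a + 2 * pi) = \<tau> a + 2 * pi \<and> (\<forall>b\<in>{a<..<a + 2 * pi}. turning a b = \<tau> b - \<tau> a)" for a
  proof -
    let ?I = "{a<..<a + 2 * pi}"
    have ne: "z b \<noteq> z a" if "b \<in> ?I" for b using that by (intro simple_less) auto
    have "(\<lambda>b. turning a b - \<tau> b) constant_on ?I"
    proof (rule constant_on_if_cis_constant)
      show "continuous_on ?I (\<lambda>b. turning a b - \<tau> b)"
        unfolding turning_def using ne
        by (intro continuous_intros continuous_on_chord_angle continuous_on_subset[OF cont]) force+
      show "cis (turning a b - \<tau> b) = 1 / z' a" if "b \<in> ?I" for b
        using cis_turning[OF ne[OF that]] zcis[of b] by (simp add: cis_divide[symmetric])
    qed auto
    then obtain C where C: "\<And>b. b \<in> ?I \<Longrightarrow> turning a b - \<tau> b = C"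
      unfolding constant_on_def by blast
    have cont_at: "(\<tau> \<longlongrightarrow> \<tau> m) (at m within S)" for m S
      using cont continuous_on_eq_continuous_at[OF open_UNIV] isCont_def tendsto_within_subset[OF _ subset_UNIV]
      by blast
    have "((\<lambda>b. turning a b - \<tau> b) \<longlongrightarrow> 0 - \<tau> a) (at_right a)"
      by (intro tendsto_intros turning_at_right cont_at)
    moreover have "\<forall>\<^sub>F b in at_right a. turning a b - \<tau> b = C"
      using eventually_at_right_real[of a "a + 2 * pi"] C by (auto elim!: eventually_mono)
    then have "((\<lambda>b. turning a b - \<tau> b) \<longlongrightarrow> C) (at_right a)" by (rule tendsto_eventually)
    ultimately have C1: "C = - \<tau> a"
      using tendsto_unique trivial_limit_at_right_real by fastforce
    have "(turning a \<longlongrightarrow> 2 * pi) (at_left (a + 2 * pi))"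
      using turning_at_left[of "a + 2 * pi"] ext[of "turning (a + 2 * pi)" "turning a", OF turning_periodic]
      by simp
    then have "((\<lambda>b. turning a b - \<tau> b) \<longlongrightarrow> 2 * pi - \<tau> (a + 2 * pi)) (at_left (a + 2 * pi))"
      by (intro tendsto_intros cont_at)
    moreover have "\<forall>\<^sub>F b in at_left (a + 2 * pi). turning a b - \<tau> b = C"
      using eventually_at_left_real[of a "a + 2 * pi"] C by (auto elim!: eventually_mono)
    then have "((\<lambda>b. turning a b - \<tau> b) \<longlongrightarrow> C) (at_left (a + 2 * pi))" by (rule tendsto_eventually)
    ultimately have "C = 2 * pi - \<tau> (a + 2 * pi)"
      using tendsto_unique trivial_limit_at_left_real by fastforce
    then show ?thesis using C C1 by (auto simp: algebra_simps)
  qed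
  have "0 \<le> \<tau> (t + u) - \<tau> t \<and> \<tau> (t + u) - \<tau> t \<le> 2 * pi" if "0 < u" "u < 2 * pi" for t u
    using conjunct2[OF key[of t]] turning_bounds[OF simple[OF that, of t]] that by simp
  then show ?thesis
    by (rule that[OF cont zcis conjunct1[OF key]])
qed

end

section \<open>The contribution of a fixed arclength gap\<close>

text \<open>The second derivative carries the factor \<open>p * (p - 1)\<close>, nonnegative in both
  ranges. Negative \<open>p\<close> serves the power \<open>- s\<close> of the chord length,
  \<open>p \<ge> 1\<close> serves Jensen's inequality.\<close>

lemma powr_ge_tangent:
  fixes x y p :: real
  assumes "p \<le> 0 \<or> 1 \<le> p" "0 < x" "0 < y"
  shows "y powr p + p * y powr (p - 1) * (x - y) \<le> x powr p"
proof -
  have "0 \<le> p * (p - 1)"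
    using assms(1) by (auto intro: mult_nonneg_nonneg mult_nonpos_nonpos)
  then have conv: "convex_on {0<..} (\<lambda>t. t powr p)"
    by (intro f''_ge0_imp_convex[where f' = "\<lambda>t. p * t powr (p - 1)"
          and f'' = "\<lambda>t. p * (p - 1) * t powr (p - 1 - 1)"])
      (auto intro!: derivative_eq_intros)
  have "p * y powr (p - 1) * (x - y) \<le> x powr p - y powr p"
    using assms(2,3)
    by (intro convex_on_imp_above_tangent[OF conv])
      (auto intro!: derivative_eq_intros simp: interior_open)
  then show ?thesis by simp
qed

text \<open>The integrals over \<open>{u..p + u}\<close> and \<open>{0..p}\<close> differ as those
  over \<open>{p..p + u}\<close> and \<open>{0..u}\<close> do, and there \<open>f\<close> differs by
  the constant \<open>d\<close>.\<close>

lemma has_integral_quasiperiodic_difference: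
  fixes f :: "real \<Rightarrow> real"
  assumes cont: "continuous_on UNIV f" and per: "\<And>t. f (t + p) = f t + d"
    and "0 \<le> u" "0 \<le> p"
  shows "((\<lambda>t. f (t + u) - f t) has_integral u * d) {0..p}"
proof -
  have int: "f integrable_on {a..b}" for a b
    by (intro integrable_continuous_interval continuous_on_subset[OF cont]) auto
  have "integral {p..p + u} f = integral {0..u} (\<lambda>t. f (t + p))"
    using integral_shift_real_ivl[of p p "p + u" f] by simp
  also have "\<dots> = integral {0..u} f + u * d"
    using \<open>0 \<le> u\<close> by (simp add: per integral_add[OF int integrable_const_ivl])
  finally have shift: "integral {p..p + u} f = integral {0..u} f + u * d" .
  have "integral {0..u} f + integral {u..p + u} f = integral {0..p} f + integral {p..p + u} f"
    using assms(3,4) by (simp add: Henstock_Kurzweil_Integration.integral_combine[OF _ _ int])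
  with shift have eq: "integral {u..p + u} f - integral {0..p} f = u * d" by simp
  have "(f has_integral integral {u..p + u} f) {u..p + u}"
    by (rule integrable_integral[OF int])
  from has_integral_shift_real_ivl[OF this, of u]
  have "((\<lambda>t. f (t + u)) has_integral integral {u..p + u} f) {0..p}" by simp
  from has_integral_diff[OF this integrable_integral[OF int]] show ?thesis by (simp add: eq)
qed

context convex_loop
begin

definition rate :: "real \<Rightarrow> real \<Rightarrow> real" where
  "rate u t = Im ((z' (t + u) - z' t) / (z (t + u) - z t))"

text \<open>Inner product of the chord from \<open>a\<close> to \<open>b\<close> with the outward
  normal \<open>- \<i> * z' b\<close>: the numerator of the curvature integrand.\<close>

definition kern :: "real \<Rightarrow> real \<Rightarrow> real" where
  "kern a b = Im (z' b * cnj (z b - z a))"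

lemma kern_nonneg: "0 \<le> kern a b"
  using convex[of b a] by (simp add: kern_def algebra_simps)

text \<open>Multiplying by the conjugate chord splits the angular velocity of the chord into the two
  curvature numerators of the pair \<open>t\<close>, \<open>t + u\<close>.\<close>

lemma rate_eq:
  "rate u t = (kern t (t + u) + kern (t + u) t) / (norm (z (t + u) - z t))\<^sup>2"
proof -
  have "rate u t = Im ((z' (t + u) - z' t) * cnj (z (t + u) - z t)) / (norm (z (t + u) - z t))\<^sup>2"
    unfolding rate_def by (subst complex_div_cnj) (simp add: Im_divide_of_real[symmetric])
  also have "Im ((z' (t + u) - z' t) * cnj (z (t + u) - z t)) = kern t (t + u) + kern (t + u) t"
    by (simp add: kern_def algebra_simps)
  finally show ?thesis .
qed

lemma rate_nonneg: "0 \<le> rate u t"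
  unfolding rate_eq by (simp add: kern_nonneg)

lemma continuous_on_rate:
  assumes "0 < u" "u < 2 * pi"
  shows "continuous_on A (rate u)"
  unfolding rate_def
  by (intro continuous_intros continuous_on_compose2[OF continuous_curve[of UNIV]]
        continuous_on_compose2[OF continuous_deriv[of UNIV]])
     (auto simp: simple[OF assms])

lemma shifted_deriv: "((\<lambda>t. z (t + u)) has_vector_derivative z' (t + u)) (at t)"
proof -
  have "((\<lambda>t. t + u) has_real_derivative 1) (at t)" by (auto intro!: derivative_eq_intros)
  then have "((\<lambda>t. t + u) has_vector_derivative 1) (at t)"
    by (simp add: has_real_derivative_iff_has_vector_derivative)
  from vector_diff_chain_at[OF this, of z] deriv[of "t + u"] show ?thesis by (simp add: o_def)
qed

text \<open>The minorant \<open>\<psi>\<close> used below agrees with the integrand for the unit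
  circle, where the chord has length \<open>w\<close> and the tangent angle grows by
  \<open>u\<close>; the bound is therefore the circle's own value.\<close>

lemma gap_energy_ge:
  fixes s u :: real
  assumes "0 < s" and u: "0 < u" "u < 2 * pi"
  defines "w \<equiv> 2 * sin (u / 2)"
  shows "ennreal (2 * pi * w powr - s)
    \<le> (\<integral>\<^sup>+t. ennreal (rate u t * norm (z (t + u) - z t) powr - s) * indicator {0..2*pi} t \<partial>lborel)"
proof -
  obtain \<tau> where cont: "continuous_on UNIV \<tau>" and cis: "\<And>t. z' t = cis (\<tau> t)"
    and per: "\<And>t. \<tau> (t + 2 * pi) = \<tau> t + 2 * pi"
    and range: "\<And>t u. 0 < u \<Longrightarrow> u < 2 * pi \<Longrightarrow> 0 \<le> \<tau> (t + u) - \<tau> t \<and> \<tau> (t + u) - \<tau> t \<le> 2 * pi"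
    by (rule tangent_angle) (rule that)
  have wpos: "0 < w" unfolding w_def using u sin_gt_zero[of "u/2"] by simp
  define r where "r = (\<lambda>t. norm (z (t + u) - z t))"
  have nz: "z (t + u) - z t \<noteq> 0" for t using simple[OF u] by simp
  then have rpos: "0 < r t" for t by (simp add: r_def)
  txt \<open>The tangent line of the convex function \<open>x\<^sup>-\<^sup>s\<close> at \<open>w\<close>, combined with the one of the
    concave sine at \<open>u/2\<close>.\<close>
  define \<psi> where "\<psi> = (\<lambda>t. (1 + s) * w powr - s * rate u t
      - s * w powr (- s - 1) * (w + cos (u / 2) * (\<tau> (t + u) - \<tau> t - u)))"
  have \<psi>_le: "\<psi> t \<le> rate u t * r t powr - s" for t
  proof -
    have "rate u t * r t \<le> norm (z' (t + u) - z' t)"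
      using order_trans[OF abs_ge_self abs_Im_le_cmod, of "(z' (t + u) - z' t) / (z (t + u) - z t)"] rpos[of t]
      by (simp add: rate_def r_def norm_divide field_simps)
    also have "z' (t + u) - z' t = cis (\<tau> t) * (exp (\<i> * of_real (\<tau> (t + u) - \<tau> t)) - 1)"
      by (simp add: cis cis_conv_exp exp_diff algebra_simps)
    \<comment> \<open>Two unit tangents span a chord of the unit circle; half the angle increment
      lies in \<open>{0..pi}\<close>, where the sine is nonnegative.\<close>
    also have "norm \<dots> = 2 * sin ((\<tau> (t + u) - \<tau> t) / 2)"
      using range[OF u, of t] sin_ge_zero[of "(\<tau> (t + u) - \<tau> t) / 2"]
      by (simp only: norm_mult norm_cis dist_exp_i_1) simp
    also have "\<dots> \<le> w + cos (u / 2) * (\<tau> (t + u) - \<tau> t - u)"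
      using sin_le_tangent[of "(\<tau> (t + u) - \<tau> t) / 2" "u / 2"] range[OF u, of t] u
      by (simp add: w_def field_simps)
    finally have "s * w powr (- s - 1) * (rate u t * r t)
        \<le> s * w powr (- s - 1) * (w + cos (u / 2) * (\<tau> (t + u) - \<tau> t - u))"
      using \<open>0 < s\<close> by (intro mult_left_mono) auto
    moreover have "(1 + s) * w powr - s - s * w powr (- s - 1) * r t \<le> r t powr - s"
    proof -
      have "w powr (- s - 1) * w = w powr - s" using wpos by (simp add: powr_diff)
      then have "(1 + s) * w powr - s - s * w powr (- s - 1) * r t
          = w powr - s + - s * w powr (- s - 1) * (r t - w)"
        by (simp add: algebra_simps)
      then show ?thesis
        using powr_ge_tangent[of "- s" "r t" w] \<open>0 < s\<close> rpos[of t] wpos by simp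
    qed
    from mult_left_mono[OF this rate_nonneg[of u t]]
    have "(1 + s) * w powr - s * rate u t - s * w powr (- s - 1) * (rate u t * r t)
        \<le> rate u t * r t powr - s"
      by (simp add: algebra_simps)
    ultimately show ?thesis unfolding \<psi>_def by linarith
  qed
  have int_rate: "(rate u has_integral 2 * pi) {0..2*pi}"
  proof -
    \<comment> \<open>Tangent angle plus angle from tangent to chord: a continuous argument of the
      chord. The second summand is periodic, so over one period only the \<open>2 * pi\<close> of
      \<open>\<tau>\<close> is gained.\<close>
    define \<phi> where "\<phi> = (\<lambda>t. \<tau> t + chord_angle t (t + u))"
    have "((\<lambda>t. Im ((z' (t + u) - z' t) / (z (t + u) - z t))) has_integral \<phi> (2 * pi) - \<phi> 0) {0..2*pi}"
    proof (rule has_integral_angular_velocity)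
      show "((\<lambda>t. z (t + u) - z t) has_vector_derivative z' (t + u) - z' t) (at t)" for t
        by (intro has_vector_derivative_diff shifted_deriv deriv)
      show "continuous_on UNIV (\<lambda>t. z' (t + u) - z' t)"
        by (intro continuous_intros continuous_on_compose2[OF continuous_deriv[of UNIV]]) auto
      show "continuous_on UNIV \<phi>"
        unfolding \<phi>_def using nz
        by (intro continuous_intros cont continuous_on_chord_angle) auto
      show "z (t + u) - z t = of_real (norm (z (t + u) - z t)) * cis (\<phi> t)" for t
      proof -
        have "cis (\<phi> t) = cis (\<tau> t) * cis (chord_angle t (t + u))"
          by (simp add: \<phi>_def cis_mult)
        also have "\<dots> = z' t * sgn ((z (t + u) - z t) / z' t)"
          using cis_chord_angle[OF simple[OF u]] by (simp add: cis)
        also have "\<dots> = (z (t + u) - z t) / of_real (norm (z (t + u) - z t))"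
          using deriv_nonzero[of t] by (simp add: sgn_eq norm_divide speed)
        finally show ?thesis using nz[of t] by simp
      qed
    qed (use nz in auto)
    moreover have "\<phi> (2 * pi) - \<phi> 0 = 2 * pi"
      using per[of 0] periodic[of 0] periodic[of u] periodic'[of 0]
      by (simp add: \<phi>_def chord_angle_def dir_def add.commute)
    ultimately show ?thesis by (simp add: rate_def[abs_def])
  qed
  \<comment> \<open>The increments of \<open>\<tau>\<close> average to \<open>u\<close>, so the
    cosine term in \<open>\<psi>\<close> integrates to zero.\<close>
  have "((\<lambda>t. \<tau> (t + u) - \<tau> t) has_integral u * (2 * pi)) {0..2*pi}"
    using u by (intro has_integral_quasiperiodic_difference cont per) auto
  from has_integral_diff[OF this has_integral_const_real[of u 0 "2*pi"]]
  have int_0: "((\<lambda>t. \<tau> (t + u) - \<tau> t - u) has_integral 0) {0..2*pi}" by simp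
  have int_w: "((\<lambda>t. w) has_integral 2 * pi * w) {0..2*pi}"
    using has_integral_const_real[of w 0 "2*pi"] by simp
  have "(\<psi> has_integral (1 + s) * w powr - s * (2 * pi)
      - s * w powr (- s - 1) * (2 * pi * w + cos (u / 2) * 0)) {0..2*pi}"
    unfolding \<psi>_def
    by (intro has_integral_diff[OF has_integral_mult_right[OF int_rate] has_integral_mult_right]
        has_integral_add int_w has_integral_mult_right int_0)
  moreover have "w powr - s = w powr (- s - 1) * w" using wpos by (simp add: powr_diff)
  then have "(1 + s) * w powr - s * (2 * pi) - s * w powr (- s - 1) * (2 * pi * w + cos (u / 2) * 0)
      = 2 * pi * w powr - s"
    by (simp add: algebra_simps)
  ultimately have int_\<psi>: "(\<psi> has_integral 2 * pi * w powr - s) {0..2*pi}" by simp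
  let ?f = "\<lambda>t. rate u t * r t powr - s"
  have "continuous_on {0..2*pi} ?f"
    unfolding r_def using nz
    by (intro continuous_intros continuous_on_rate u continuous_on_compose2[OF continuous_curve[of UNIV]]) auto
  then have int_f: "(?f has_integral integral {0..2*pi} ?f) {0..2*pi}"
    by (intro integrable_integral integrable_continuous_interval)
  have "2 * pi * w powr - s \<le> integral {0..2*pi} ?f"
    using has_integral_le[OF int_\<psi> int_f] \<psi>_le by simp
  then have "ennreal (2 * pi * w powr - s) \<le> ennreal (integral {0..2*pi} ?f)" by (rule ennreal_leI)
  also have "\<dots> = (\<integral>\<^sup>+t. ennreal (?f t) * indicator {0..2*pi} t \<partial>lborel)"
    by (rule nn_integral_has_integral_lebesgue'[symmetric, OF _ int_f]) (simp add: rate_nonneg)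
  finally show ?thesis by (simp add: r_def)
qed

end

section \<open>The total nonlocal curvature and Jensen's inequality\<close>

text \<open>For finite positive \<open>h\<close> the tangent line of the power at \<open>h\<close>
  is integrated. With \<open>h\<close> a lower bound for the mean rather than the mean itself, the
  value of the circle can be inserted directly.\<close>

lemma enn_powr_jensen:
  assumes [measurable]: "H \<in> borel_measurable M" and M: "emeasure M (space M) = ennreal m" "0 \<le> m"
    and p: "1 \<le> p" and mean: "ennreal m * h \<le> (\<integral>\<^sup>+x. H x \<partial>M)"
  shows "ennreal m * enn_powr h p \<le> (\<integral>\<^sup>+x. enn_powr (H x) p \<partial>M)"
proof -
  have [measurable]: "(\<lambda>x. enn_powr (H x) p) \<in> borel_measurable M"
    unfolding enn_powr_def by measurable
  consider "m = 0" | "m > 0" "h = \<infinity>" | y where "m > 0" "h = ennreal y" "y \<ge> 0"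
    using M(2) by (cases h) (auto simp: less_eq_real_def infinity_ennreal_def)
  then show ?thesis
  proof cases
    case 1
    then show ?thesis by simp
  next
    case 2
    \<comment> \<open>As the measure is finite, this bound passes an infinite integral of
      \<open>H\<close> on to that of its power.\<close>
    have "H x \<le> 1 + enn_powr (H x) p" for x
    proof (cases "H x")
      case (real y)
      have "y \<le> 1 + y powr p"
        using powr_mono[of 1 p y] p real by (cases "y \<le> 1") (auto intro: add_increasing2)
      then show ?thesis using real
        by (simp add: enn_powr_def flip: ennreal_1 ennreal_plus del: ennreal_1)
    qed (simp add: enn_powr_def)
    then have "(\<integral>\<^sup>+x. H x \<partial>M) \<le> (\<integral>\<^sup>+x. 1 + enn_powr (H x) p \<partial>M)"
      by (intro nn_integral_mono)
    also have "\<dots> = ennreal m + (\<integral>\<^sup>+x. enn_powr (H x) p \<partial>M)"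
      by (subst nn_integral_add) (simp_all add: M)
    finally have "ennreal m + (\<integral>\<^sup>+x. enn_powr (H x) p \<partial>M) = \<infinity>"
      using mean 2 by (auto simp: ennreal_mult_top top_unique)
    then show ?thesis by (auto simp: ennreal_add_eq_top)
  next
    case (3 y)
    show ?thesis
    proof (cases "y = 0")
      case True
      then show ?thesis using 3 by (simp add: enn_powr_def)
    next
      case False
      then have y: "0 < y" using 3 by simp
      \<comment> \<open>The tangent line at \<open>y\<close>, its nonpositive constant moved to the
        other side to avoid subtraction in \<open>ennreal\<close>.\<close>
      have "ennreal (p * y powr (p - 1)) * H x \<le> enn_powr (H x) p + ennreal ((p - 1) * y powr p)" for x
      proof (cases "H x")
        case (real t)
        have "y powr (p - 1) * y = y powr p" using y by (simp add: powr_diff)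
        then have "p * y powr (p - 1) * t - (p - 1) * y powr p = y powr p + p * y powr (p - 1) * (t - y)"
          by (simp add: algebra_simps)
        also have "\<dots> \<le> t powr p"
        proof (cases "t = 0")
          case True
          then show ?thesis using p y by (simp add: powr_diff field_simps)
        next
          case False
          then show ?thesis using powr_ge_tangent[of p t y] p y real by simp
        qed
        finally have "p * y powr (p - 1) * t \<le> t powr p + (p - 1) * y powr p" by simp
        then show ?thesis using p real
          by (simp add: enn_powr_def flip: ennreal_plus ennreal_mult)
      qed (simp add: enn_powr_def)
      then have "(\<integral>\<^sup>+x. ennreal (p * y powr (p - 1)) * H x \<partial>M)
          \<le> (\<integral>\<^sup>+x. enn_powr (H x) p + ennreal ((p - 1) * y powr p) \<partial>M)"
        by (intro nn_integral_mono)
      also have "\<dots> = (\<integral>\<^sup>+x. enn_powr (H x) p \<partial>M) + ennreal ((p - 1) * y powr p) * ennreal m"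
        by (subst nn_integral_add) (simp_all add: M)
      also have "(\<integral>\<^sup>+x. ennreal (p * y powr (p - 1)) * H x \<partial>M)
          = ennreal (p * y powr (p - 1)) * (\<integral>\<^sup>+x. H x \<partial>M)"
        by (rule nn_integral_cmult) simp
      finally have upper: "ennreal (p * y powr (p - 1)) * (\<integral>\<^sup>+x. H x \<partial>M)
          \<le> (\<integral>\<^sup>+x. enn_powr (H x) p \<partial>M) + ennreal ((p - 1) * y powr p * m)"
        using p M(2) by (simp add: ennreal_mult)
      have "y powr (p - 1) * y = y powr p" using y by (simp add: powr_diff)
      then have "p * y powr (p - 1) * (m * y) = m * y powr p + (p - 1) * y powr p * m"
        by (simp add: algebra_simps)
      then have "ennreal (m * y powr p) + ennreal ((p - 1) * y powr p * m)
          = ennreal (p * y powr (p - 1)) * (ennreal m * h)"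
        using p y M(2) 3 by (simp flip: ennreal_plus ennreal_mult)
      also have "\<dots> \<le> ennreal (p * y powr (p - 1)) * (\<integral>\<^sup>+x. H x \<partial>M)"
        by (intro mult_left_mono mean) simp
      also note upper
      finally have "ennreal (m * y powr p) \<le> (\<integral>\<^sup>+x. enn_powr (H x) p \<partial>M)"
        using ennreal_add_left_cancel_le[of "ennreal ((p - 1) * y powr p * m)"]
        by (simp add: add.commute)
      then show ?thesis using 3 M(2) by (simp add: enn_powr_def ennreal_mult)
    qed
  qed
qed

text \<open>This may be infinite, when \<open>s \<ge> 1\<close>; by treating that case too, Jensen's inequality above spares us
  showing that it is finite.\<close>

definition circle_curvature :: "real \<Rightarrow> ennreal" where
  "circle_curvature s =
    (\<integral>\<^sup>+u. ennreal ((2 * sin (u / 2)) powr - s / 2) * indicator {0..2*pi} u \<partial>lborel)"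

context convex_loop
begin

definition curvature_density :: "real \<Rightarrow> real \<Rightarrow> real \<Rightarrow> ennreal" where
  "curvature_density s a b = ennreal (kern a b / norm (z b - z a) powr (2 + s))"

lemma measurable_curve [measurable]: "z \<in> borel_measurable borel" "z' \<in> borel_measurable borel"
  by (intro borel_measurable_continuous_onI continuous_curve continuous_deriv)+

lemma measurable_curvature_density [measurable]:
  "(\<lambda>(a, b). curvature_density s a b) \<in> borel_measurable (borel \<Otimes>\<^sub>M borel)"
proof -
  have [measurable]: "cnj \<in> borel_measurable borel"
    by (intro borel_measurable_continuous_onI continuous_intros)
  have [measurable]: "(\<lambda>p. cnj (z (snd p) - z (fst p))) \<in> borel_measurable (borel \<Otimes>\<^sub>M borel)"
    by (rule measurable_compose[of _ _ borel]) measurable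
  show ?thesis unfolding curvature_density_def kern_def split_beta' by measurable
qed

lemma curvature_density_periodic: "curvature_density s (a + 2 * pi) b = curvature_density s a b" "curvature_density s a (b + 2 * pi) = curvature_density s a b"
  by (simp_all add: curvature_density_def kern_def periodic periodic')

lemma curvature_density_symmetrized:
  assumes "z (t + u) \<noteq> z t"
  shows "curvature_density s t (t + u) + curvature_density s (t + u) t = ennreal (rate u t * norm (z (t + u) - z t) powr - s)"
proof -
  let ?r = "norm (z (t + u) - z t)"
  have "?r powr (2 + s) = ?r\<^sup>2 * ?r powr s"
    using assms by (simp add: powr_add)
  then have "rate u t * ?r powr - s = kern t (t + u) / ?r powr (2 + s) + kern (t + u) t / ?r powr (2 + s)"
    by (simp add: rate_eq powr_minus_divide add_divide_distrib)
  then show ?thesis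
    unfolding curvature_density_def by (simp add: kern_nonneg norm_minus_commute flip: ennreal_plus)
qed

text \<open>The pairs \<open>(a, b)\<close> are sorted by their gap \<open>b - a\<close>, and the
  gap \<open>u\<close> is averaged with \<open>2 * pi - u\<close>. This matches each pair with its
  reversal, and the symmetrized density is the one bounded by \<open>gap_energy_ge\<close>.\<close>

lemma total_curvature_ge:
  assumes "0 < s"
  shows "ennreal (2 * pi) * circle_curvature s
    \<le> (\<integral>\<^sup>+a. (\<integral>\<^sup>+b. curvature_density s a b * indicator {0..2*pi} b \<partial>lborel) * indicator {0..2*pi} a \<partial>lborel)"
proof -
  let ?I = "indicator {0..2*pi} :: real \<Rightarrow> ennreal"
  define J where "J = (\<lambda>u. \<integral>\<^sup>+a. curvature_density s a (a + u) * ?I a \<partial>lborel)"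
  have [measurable]: "J \<in> borel_measurable borel" unfolding J_def by measurable
  have "(\<integral>\<^sup>+a. (\<integral>\<^sup>+b. curvature_density s a b * ?I b \<partial>lborel) * ?I a \<partial>lborel)
      = (\<integral>\<^sup>+a. (\<integral>\<^sup>+u. curvature_density s a (u + a) * ?I u \<partial>lborel) * ?I a \<partial>lborel)"
  proof (intro nn_integral_cong)
    fix a
    show "(\<integral>\<^sup>+b. curvature_density s a b * ?I b \<partial>lborel) * ?I a = (\<integral>\<^sup>+u. curvature_density s a (u + a) * ?I u \<partial>lborel) * ?I a"
      using nn_integral_periodic_shift[of "curvature_density s a" "2*pi" a] curvature_density_periodic
      by (auto simp: indicator_def)
  qed
  also have "\<dots> = (\<integral>\<^sup>+a. (\<integral>\<^sup>+u. curvature_density s a (a + u) * ?I u * ?I a \<partial>lborel) \<partial>lborel)"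
    by (intro nn_integral_cong nn_integral_multc[symmetric, THEN trans]) (auto simp: add.commute)
  also have "\<dots> = (\<integral>\<^sup>+u. (\<integral>\<^sup>+a. curvature_density s a (a + u) * ?I u * ?I a \<partial>lborel) \<partial>lborel)"
    by (rule lborel_pair.Fubini'[symmetric]) measurable
  also have "\<dots> = (\<integral>\<^sup>+u. J u * ?I u \<partial>lborel)"
    unfolding J_def by (intro nn_integral_cong) (auto simp: indicator_def)
  finally have total: "(\<integral>\<^sup>+a. (\<integral>\<^sup>+b. curvature_density s a b * ?I b \<partial>lborel) * ?I a \<partial>lborel)
      = (\<integral>\<^sup>+u. J u * ?I u \<partial>lborel)" .
  \<comment> \<open>By periodicity the gap \<open>2 * pi - u\<close> leads from \<open>a\<close> to
    \<open>a - u\<close>; translating \<open>a\<close> by \<open>u\<close> yields the reversed pair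
    \<open>(a + u, a)\<close>.\<close>
  have J_reflect: "J (2 * pi - u) = (\<integral>\<^sup>+a. curvature_density s (a + u) a * ?I a \<partial>lborel)" if "u \<in> {0..2*pi}" for u
  proof -
    have "curvature_density s a (a + (2 * pi - u)) = curvature_density s a (a - u)" for a
      using curvature_density_periodic(2)[of s a "a - u"] by (simp add: algebra_simps)
    then have J_eq: "J (2 * pi - u) = (\<integral>\<^sup>+a. curvature_density s a (a - u) * ?I a \<partial>lborel)"
      by (simp add: J_def)
    have "curvature_density s (a + 2 * pi) (a + 2 * pi - u) = curvature_density s a (a - u)" for a
      using curvature_density_periodic(1)[of s a "a + 2 * pi - u"] curvature_density_periodic(2)[of s a "a - u"]
      by (simp add: algebra_simps)
    then have "(\<integral>\<^sup>+a. curvature_density s a (a - u) * ?I a \<partial>lborel) = (\<integral>\<^sup>+a. curvature_density s (a + u) a * ?I a \<partial>lborel)"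
      using nn_integral_periodic_shift[of "\<lambda>a. curvature_density s a (a - u)" "2*pi" u] that by simp
    then show ?thesis by (simp add: J_eq)
  qed
  have "(\<integral>\<^sup>+u. J u * ?I u \<partial>lborel) = (\<integral>\<^sup>+u. J (2 * pi - u) * ?I u \<partial>lborel)"
  proof -
    have "(\<integral>\<^sup>+u. J u * ?I u \<partial>lborel) = (\<integral>\<^sup>+u. J (2 * pi - u) * ?I (2 * pi - u) \<partial>lborel)"
      using nn_integral_real_affine[of "\<lambda>u. J u * ?I u" "-1" "2*pi"] by simp
    also have "\<dots> = (\<integral>\<^sup>+u. J (2 * pi - u) * ?I u \<partial>lborel)"
      by (intro nn_integral_cong arg_cong2[where f = "(*)"]) (auto simp: indicator_def)
    finally show ?thesis .
  qed
  moreover have "(\<integral>\<^sup>+u. J u * ?I u + J (2 * pi - u) * ?I u \<partial>lborel)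
      = (\<integral>\<^sup>+u. J u * ?I u \<partial>lborel) + (\<integral>\<^sup>+u. J (2 * pi - u) * ?I u \<partial>lborel)"
    by (rule nn_integral_add) measurable
  ultimately have "2 * (\<integral>\<^sup>+u. J u * ?I u \<partial>lborel) = (\<integral>\<^sup>+u. J u * ?I u + J (2 * pi - u) * ?I u \<partial>lborel)"
    by (metis mult_2)
  also have "\<dots> \<ge> (\<integral>\<^sup>+u. ennreal (2 * pi * (2 * sin (u / 2)) powr - s) * ?I u \<partial>lborel)"
  proof (intro nn_integral_mono_AE)
    have gap: "ennreal (2 * pi * (2 * sin (u / 2)) powr - s) \<le> J u + J (2 * pi - u)"
      if u: "0 < u" "u < 2 * pi" for u
    proof -
      have "J u + J (2 * pi - u)
          = (\<integral>\<^sup>+a. curvature_density s a (a + u) * ?I a + curvature_density s (a + u) a * ?I a \<partial>lborel)"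
        using u by (subst nn_integral_add) (simp_all add: J_reflect, simp add: J_def)
      also have "\<dots> = (\<integral>\<^sup>+t. ennreal (rate u t * norm (z (t + u) - z t) powr - s) * ?I t \<partial>lborel)"
        by (simp add: curvature_density_symmetrized[OF simple[OF u]] flip: distrib_right)
      finally show ?thesis using gap_energy_ge[OF \<open>0 < s\<close> u] by simp
    qed
    \<comment> \<open>The gaps \<open>0\<close> and \<open>2 * pi\<close>, which join a point to
      itself, form a null set.\<close>
    show "AE u in lborel. ennreal (2 * pi * (2 * sin (u / 2)) powr - s) * ?I u
        \<le> J u * ?I u + J (2 * pi - u) * ?I u"
      using AE_lborel_singleton[of 0] AE_lborel_singleton[of "2*pi"]
      by eventually_elim (use gap in \<open>auto simp: indicator_def\<close>)
  qed
  \<comment> \<open>The integrand of \<open>circle_curvature\<close> carries a factor 1/2, so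
    \<open>2 * pi\<close> becomes \<open>4 * pi\<close>; one factor 2 then cancels the doubling by
    reflection.\<close>
  also have "(\<integral>\<^sup>+u. ennreal (2 * pi * (2 * sin (u / 2)) powr - s) * ?I u \<partial>lborel)
      = (\<integral>\<^sup>+u. ennreal (4 * pi) * (ennreal ((2 * sin (u / 2)) powr - s / 2) * ?I u) \<partial>lborel)"
    by (intro nn_integral_cong) (auto simp: indicator_def simp flip: ennreal_mult)
  also have "\<dots> = ennreal (4 * pi) * circle_curvature s"
    unfolding circle_curvature_def by (rule nn_integral_cmult) measurable
  also have "ennreal (4 * pi) = 2 * ennreal (2 * pi)"
    by (simp flip: ennreal_numeral ennreal_mult)
  finally have "2 * (ennreal (2 * pi) * circle_curvature s) \<le> 2 * (\<integral>\<^sup>+u. J u * ?I u \<partial>lborel)"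
    by (simp add: mult.assoc)
  then have "ennreal (2 * pi) * circle_curvature s \<le> (\<integral>\<^sup>+u. J u * ?I u \<partial>lborel)"
    by (subst (asm) ennreal_mult_le_mult_iff) auto
  then show ?thesis by (simp add: total)
qed

end

section \<open>Orientation of the admissible curves\<close>

lemma nn_integral_arc_measure:
  "(\<integral>\<^sup>+x. f x \<partial>arc_measure) = (\<integral>\<^sup>+x. f x * indicator {0..2*pi} x \<partial>lborel)"
  unfolding arc_measure_def by (rule nn_integral_restrict_space) simp

lemma emeasure_arc_measure: "emeasure arc_measure (space arc_measure) = ennreal (2 * pi)"
  by (simp add: arc_measure_def space_restrict_space emeasure_restrict_space)

lemma cis_add_neq:
  assumes "0 < u" "u < 2 * pi"
  shows "cis (t + u) \<noteq> cis t"
proof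
  assume "cis (t + u) = cis t"
  then have "cis t * cis u = cis t * 1" by (simp add: cis_mult)
  then have "cis u = 1" by (simp only: mult_cancel_left) simp
  then have "cos u = 1" by (metis cis.sel(1) one_complex.sel(1))
  then obtain n :: int where n: "u = of_int n * 2 * pi"
    by (metis cos_one_2pi_int)
  then have "0 < n" "n < 1" using assms by (auto simp: zero_less_mult_iff mult_less_cancel_right)
  then show False by simp
qed

lemma lift_periodic: "lift \<gamma> (t + 2 * pi) = lift \<gamma> t"
  by (simp add: lift_def cis_mult[symmetric])

lemma norm_real_2: "norm (v :: real^2) = sqrt ((v $ 1)\<^sup>2 + (v $ 2)\<^sup>2)"
  by (simp add: norm_vec_def L2_set_def sum_2)

lemma inner_real_2: "(v :: real^2) \<bullet> w = v $ 1 * w $ 1 + v $ 2 * w $ 2"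
  by (simp add: inner_vec_def sum_2)

locale admissible_curve =
  fixes \<gamma> :: "complex \<Rightarrow> real^2"
  assumes in_X: "\<gamma> \<in> X"
begin

abbreviation "g \<equiv> lift \<gamma>"
abbreviation "g' \<equiv> arc_deriv \<gamma>"

lemma g_deriv: "(g has_vector_derivative g' t) (at t)"
  using in_X unfolding X_def C1_differentiable_on_eq arc_deriv_def
  by (auto simp: vector_derivative_works)

lemma continuous_g': "continuous_on UNIV g'"
  using in_X unfolding X_def C1_differentiable_on_eq arc_deriv_def[abs_def] by auto

lemma continuous_g: "continuous_on A g"
  using g_deriv by (auto intro!: continuous_at_imp_continuous_on has_vector_derivative_continuous)

lemma norm_g': "norm (g' t) = 1"
  using in_X by (simp add: X_def)

lemma g'_periodic: "g' (t + 2 * pi) = g' t"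
proof -
  have "((\<lambda>t. t + 2 * pi) has_real_derivative 1) (at t)" by (auto intro!: derivative_eq_intros)
  then have "((\<lambda>t. t + 2 * pi) has_vector_derivative 1) (at t)"
    by (simp add: has_real_derivative_iff_has_vector_derivative)
  from vector_diff_chain_at[OF this g_deriv] have "(g has_vector_derivative g' (t + 2 * pi)) (at t)"
    by (simp add: o_def lift_periodic)
  from vector_derivative_at[OF this] vector_derivative_at[OF g_deriv[of t]] show ?thesis by simp
qed

lemma g_simple:
  assumes "0 < u" "u < 2 * pi"
  shows "g (t + u) \<noteq> g t"
proof -
  obtain k where "homeomorphism (sphere 0 1) (\<gamma> ` sphere 0 1) \<gamma> k"
    using in_X by (auto simp: X_def)
  then have "inj_on \<gamma> (sphere 0 1)" by (metis homeomorphism_apply1 inj_on_inverseI)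
  then show ?thesis using cis_add_neq[OF assms, of t] by (auto simp: lift_def inj_on_def)
qed

text \<open>Cross product of the tangent at \<open>a\<close> with the chord to \<open>b\<close>; its
  sign tells the side of the tangent line.\<close>

definition side :: "real \<Rightarrow> real \<Rightarrow> real" where
  "side a b = g' a $ 1 * (g b - g a) $ 2 - g' a $ 2 * (g b - g a) $ 1"

text \<open>\<open>\<nu> \<bullet> g b\<close> is maximal at \<open>b = a\<close>, so
  \<open>\<nu>\<close> is orthogonal to the tangent and equals \<open>l * perp (g' a)\<close> with
  \<open>l \<noteq> 0\<close>; convexity then reads \<open>0 \<le> l * side a b\<close>.\<close>

lemma side_sign:
  "(\<forall>b. 0 \<le> side a b) \<or> (\<forall>b. side a b \<le> 0)"
proof -
  have "convex_curve \<gamma>" using in_X by (simp add: X_def)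
  then obtain \<nu> where \<nu>: "norm \<nu> = 1" "\<And>y. y \<in> sphere 0 1 \<Longrightarrow> 0 \<le> \<nu> \<bullet> (\<gamma> (cis a) - \<gamma> y)"
    unfolding convex_curve_def by (metis dist_0_norm mem_sphere norm_cis)
  then have sup: "0 \<le> \<nu> \<bullet> (g a - g b)" for b by (simp add: lift_def)
  have "((\<lambda>b. \<nu> \<bullet> g b) has_vector_derivative \<nu> \<bullet> g' a) (at a)"
    by (rule bounded_linear.has_vector_derivative[OF bounded_linear_inner_right g_deriv])
  then have "((\<lambda>b. \<nu> \<bullet> g b) has_real_derivative \<nu> \<bullet> g' a) (at a)"
    by (simp add: has_real_derivative_iff_has_vector_derivative)
  then have orth: "\<nu> \<bullet> g' a = 0"
    by (rule DERIV_local_max[where d = 1]) (use sup in \<open>auto simp: inner_diff_right\<close>)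
  define n1 n2 v1 v2 where "n1 = \<nu> $ 1" "n2 = \<nu> $ 2" "v1 = g' a $ 1" "v2 = g' a $ 2"
  note defs = this
  define l where "l = n1 * v2 - n2 * v1"
  have eqs: "n1 * v1 + n2 * v2 = 0" "n1\<^sup>2 + n2\<^sup>2 = 1" "v1\<^sup>2 + v2\<^sup>2 = 1"
    using orth \<nu>(1) norm_g'[of a] by (simp_all add: norm_real_2 inner_real_2 defs)
  have l1: "n1 = l * v2" unfolding l_def using eqs by algebra
  have l2: "n2 = - l * v1" unfolding l_def using eqs by algebra
  have "0 \<le> l * side a b" for b
  proof -
    have "\<nu> \<bullet> (g a - g b) = l * side a b"
      unfolding inner_real_2 side_def using l1 l2 by (simp add: defs algebra_simps)
    then show ?thesis using sup[of b] by simp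
  qed
  moreover have "l \<noteq> 0" using l1 l2 eqs(2) by auto
  ultimately show ?thesis
    by (cases "l > 0") (auto simp: zero_le_mult_iff)
qed

text \<open>If both signs occurred at one point, the curve would lie on a line; but a continuous
  function on the circle takes equal values at some pair of antipodal points.\<close>

lemma side_nonzero: "\<exists>b. side a b \<noteq> 0"
proof (rule ccontr)
  assume "\<not> ?thesis"
  then have zero: "side a b = 0" for b by simp
  define k where "k = (\<lambda>t. g' a \<bullet> (g (t + pi) - g t))"
  have "k pi = - k 0"
    using lift_periodic[of \<gamma> 0] by (simp add: k_def inner_diff_right)
  moreover have cont: "continuous_on {0..pi} k"
    unfolding k_def by (intro continuous_intros continuous_on_compose2[OF continuous_g[of UNIV]]) auto
  ultimately have "\<exists>t. 0 \<le> t \<and> t \<le> pi \<and> k t = 0"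
    using IVT'[of k 0 0 pi] IVT2'[of k pi 0 0] by (cases "k 0 \<le> 0") auto
  then obtain t where "k t = 0" by blast
  define v1 v2 w1 w2 where "v1 = g' a $ 1" "v2 = g' a $ 2"
    "w1 = (g (t + pi) - g t) $ 1" "w2 = (g (t + pi) - g t) $ 2"
  note defs = this
  have "v1 * w1 + v2 * w2 = 0" using \<open>k t = 0\<close> by (simp add: k_def inner_real_2 defs)
  moreover have "v1 * w2 - v2 * w1 = 0"
    using zero[of "t + pi"] zero[of t] by (simp add: side_def defs algebra_simps)
  moreover have "v1\<^sup>2 + v2\<^sup>2 = 1" using norm_g'[of a] by (simp add: norm_real_2 defs)
  ultimately have "w1 = 0" "w2 = 0" by algebra+
  then have "g (t + pi) = g t" by (simp add: defs vec_eq_iff forall_2)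
  then show False using g_simple[of pi t] by simp
qed

text \<open>The parameters at which the curve lies on one or the other side form two closed sets
  covering the line; \<open>side_nonzero\<close> makes them disjoint, so by connectedness one is
  empty.\<close>

lemma orientation:
  obtains \<sigma> :: real where "\<sigma> = 1 \<or> \<sigma> = -1" "\<And>a b. 0 \<le> \<sigma> * side a b"
proof -
  let ?A = "{a. \<forall>b. 0 \<le> side a b}" and ?B = "{a. \<forall>b. side a b \<le> 0}"
  have cont: "continuous_on UNIV (\<lambda>a. side a b)" for b
    unfolding side_def by (intro continuous_intros continuous_g continuous_g')
  have "closed ?A" "closed ?B"
    by (intro closed_Collect_all closed_Collect_le cont continuous_intros)+
  moreover have cover: "UNIV \<subseteq> ?A \<union> ?B" using side_sign by blast
  moreover have disjoint: "\<not> ((\<forall>b. 0 \<le> side a b) \<and> (\<forall>b. side a b \<le> 0))" for a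
    using side_nonzero[of a] by (meson order_antisym)
  then have "?A \<inter> ?B \<inter> UNIV = {}" by blast
  ultimately have "?A \<inter> UNIV = {} \<or> ?B \<inter> UNIV = {}"
    using connected_UNIV[where 'a = real] unfolding connected_closed by metis
  with cover have "?A = UNIV \<or> ?B = UNIV"
    by (metis Int_UNIV_right Un_empty_left Un_empty_right top.extremum_uniqueI)
  then show ?thesis
  proof
    assume "?A = UNIV"
    then show ?thesis using that[of 1] by auto
  next
    assume "?B = UNIV"
    then show ?thesis using that[of "-1"] by auto
  qed
qed

text \<open>A clockwise curve is reflected in the first axis, which reverses orientation and keeps
  lengths. The inner integral of the original curve differs only by the sign
  \<open>\<sigma>\<close>, which the absolute value removes.\<close>

lemma convex_loop_exists:
  obtains z z' where "convex_loop z z'"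
    "\<And>s x. e2ennreal \<bar>nonlocal_curvature s \<gamma> x\<bar> = (\<integral>\<^sup>+y. convex_loop.curvature_density z z' s x y \<partial>arc_measure)"
proof -
  obtain \<sigma> :: real where \<sigma>: "\<sigma> = 1 \<or> \<sigma> = -1" and pos: "\<And>a b. 0 \<le> \<sigma> * side a b"
    using orientation by metis
  have sq: "\<sigma>\<^sup>2 = 1" using \<sigma> by auto
  define E where "E = (\<lambda>v::real^2. Complex (v $ 1) (\<sigma> * v $ 2))"
  have lin: "linear E"
    by (rule linearI) (simp_all add: E_def complex_eq_iff algebra_simps)
  then have bl: "bounded_linear E" by (simp add: linear_conv_bounded_linear)
  have norm_E: "norm (E v) = norm v" for v
    by (simp add: E_def norm_real_2 complex_norm power_mult_distrib sq)
  have diff_E: "E v - E w = E (v - w)" for v w by (simp add: linear_diff[OF lin])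
  define z where "z = (\<lambda>t. E (g t))"
  define z' where "z' = (\<lambda>t. E (g' t))"
  have loop: "convex_loop z z'"
  proof
    show "(z has_vector_derivative z' t) (at t)" for t
      unfolding z_def z'_def by (rule bounded_linear.has_vector_derivative[OF bl g_deriv])
    show "continuous_on UNIV z'"
      unfolding z'_def using linear_continuous_on_compose[OF continuous_g' lin] by simp
    show "z (t + 2 * pi) = z t" "z' (t + 2 * pi) = z' t" "norm (z' t) = 1" for t
      by (simp_all add: z_def z'_def lift_periodic g'_periodic norm_E norm_g')
    show "z (t + u) \<noteq> z t" if "0 < u" "u < 2 * pi" for t u
    proof
      assume "z (t + u) = z t"
      then have "norm (E (g (t + u) - g t)) = 0" by (simp add: z_def diff_E[symmetric])
      then show False using g_simple[OF that, of t] by (simp add: norm_E)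
    qed
    show "0 \<le> Im (cnj (z' a) * (z b - z a))" for a b
      using pos[of a b] unfolding z_def z'_def diff_E by (simp add: E_def side_def algebra_simps)
  qed
  interpret convex_loop z z' by (rule loop)
  have curv: "e2ennreal \<bar>nonlocal_curvature s \<gamma> x\<bar> = (\<integral>\<^sup>+y. curvature_density s x y \<partial>arc_measure)" for s x
  proof -
    define G where "G = (\<lambda>y. kern x y / norm (z y - z x) powr (2 + s))"
    have nonneg: "0 \<le> G y" for y by (simp add: G_def kern_nonneg)
    have "kern x y = \<sigma> * (perp (g' y) \<bullet> (g y - g x))" for y
      unfolding kern_def unfolding z_def z'_def diff_E
      by (simp add: E_def perp_def inner_real_2 algebra_simps)
    moreover have "\<sigma> * (\<sigma> * c) = c" for c
      using sq by (simp add: power2_eq_square flip: mult.assoc)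
    ultimately have "perp (g' y) \<bullet> (g y - g x) = \<sigma> * kern x y" for y
      by simp
    then have "nonlocal_curvature s \<gamma> x = ext_integral arc_measure (\<lambda>y. \<sigma> * G y)"
      unfolding nonlocal_curvature_def by (simp add: norm_g' G_def z_def diff_E norm_E)
    moreover have "\<bar>ext_integral arc_measure (\<lambda>y. \<sigma> * G y)\<bar> = enn2ereal (\<integral>\<^sup>+y. ennreal (G y) \<partial>arc_measure)"
      using \<sigma> nonneg by (auto simp: ext_integral_def ennreal_neg zero_ennreal.rep_eq)
    ultimately show ?thesis by (simp add: curvature_density_def G_def)
  qed
  show ?thesis by (rule that[OF loop curv])
qed

end

lemma W_ge_circle:
  assumes "\<gamma> \<in> X" "0 < s" "s < 1"
  shows "ennreal (2 * pi) * enn_powr (circle_curvature s) (1 / s) \<le> W s \<gamma>"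
proof -
  interpret admissible_curve \<gamma> by standard fact
  obtain z z' where loop: "convex_loop z z'" and curv:
    "\<And>s x. e2ennreal \<bar>nonlocal_curvature s \<gamma> x\<bar> = (\<integral>\<^sup>+y. convex_loop.curvature_density z z' s x y \<partial>arc_measure)"
    by (rule convex_loop_exists) (rule that)
  interpret convex_loop z z' by (rule loop)
  let ?H = "\<lambda>x. \<integral>\<^sup>+y. curvature_density s x y \<partial>arc_measure"
  have "?H \<in> borel_measurable lborel"
    unfolding nn_integral_arc_measure by measurable
  then have "?H \<in> borel_measurable arc_measure"
    unfolding arc_measure_def by (rule measurable_restrict_space1)
  moreover have "ennreal (2 * pi) * circle_curvature s \<le> (\<integral>\<^sup>+x. ?H x \<partial>arc_measure)"
    using total_curvature_ge[OF \<open>0 < s\<close>] by (simp add: nn_integral_arc_measure)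
  \<comment> \<open>Here \<open>s < 1\<close> enters: it makes the exponent \<open>1 / s\<close> at
    least 1.\<close>
  ultimately have "ennreal (2 * pi) * enn_powr (circle_curvature s) (1 / s)
      \<le> (\<integral>\<^sup>+x. enn_powr (?H x) (1 / s) \<partial>arc_measure)"
    using assms by (intro enn_powr_jensen emeasure_arc_measure) auto
  also have "\<dots> = W s \<gamma>" by (simp add: W_def norm_g' curv)
  finally show ?thesis .
qed

section \<open>The unit circle\<close>

definition unit_circle :: "complex \<Rightarrow> real^2" where
  "unit_circle w = vector [Re w, Im w]"

lemma lift_unit_circle: "lift unit_circle t = vector [cos t, sin t]"
  by (simp add: lift_def unit_circle_def)

lemma unit_circle_deriv:
  "(lift unit_circle has_vector_derivative vector [- sin t, cos t]) (at t)"
proof -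
  have eq: "lift unit_circle = (\<lambda>t. cos t *\<^sub>R axis 1 1 + sin t *\<^sub>R axis 2 1)"
    by (auto simp: lift_unit_circle vec_eq_iff forall_2 axis_def)
  have "((\<lambda>t. cos t *\<^sub>R axis 1 1 + sin t *\<^sub>R axis 2 1 :: real^2) has_vector_derivative
      (- sin t) *\<^sub>R axis 1 1 + cos t *\<^sub>R axis 2 1) (at t)"
    by (auto intro!: derivative_eq_intros)
  also have "(- sin t) *\<^sub>R axis 1 1 + cos t *\<^sub>R axis 2 1 = (vector [- sin t, cos t] :: real^2)"
    by (auto simp: vec_eq_iff forall_2 axis_def)
  finally show ?thesis by (simp add: eq)
qed

lemma arc_deriv_unit_circle: "arc_deriv unit_circle t = vector [- sin t, cos t]"
  unfolding arc_deriv_def by (rule vector_derivative_at[OF unit_circle_deriv])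

lemma unit_circle_in_X: "unit_circle \<in> X"
proof -
  have "continuous_on UNIV (\<lambda>t. vector [- sin t, cos t] :: real^2)"
  proof -
    have eq: "(\<lambda>t. vector [- sin t, cos t] :: real^2) = (\<lambda>t. (- sin t) *\<^sub>R axis 1 1 + cos t *\<^sub>R axis 2 1)"
      by (auto simp: vec_eq_iff forall_2 axis_def)
    show ?thesis unfolding eq by (intro continuous_intros)
  qed
  then have "lift unit_circle C1_differentiable_on UNIV"
    unfolding C1_differentiable_on_def
    by (intro exI[of _ "\<lambda>t. vector [- sin t, cos t]"]) (simp add: unit_circle_deriv)
  moreover have "homeomorphism (sphere 0 1) (unit_circle ` sphere 0 1) unit_circle (\<lambda>v. Complex (v $ 1) (v $ 2))"
  proof (rule homeomorphismI)
    have eq: "unit_circle = (\<lambda>w. Re w *\<^sub>R axis 1 1 + Im w *\<^sub>R axis 2 1)"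
      by (auto simp: unit_circle_def vec_eq_iff forall_2 axis_def)
    show "continuous_on (sphere 0 1) unit_circle" unfolding eq by (intro continuous_intros)
    show "continuous_on (unit_circle ` sphere 0 1) (\<lambda>v. Complex (v $ 1) (v $ 2))"
      unfolding Complex_eq by (intro continuous_intros)
  qed (auto simp: unit_circle_def)
  moreover have "norm (arc_deriv unit_circle t) = 1" for t
    by (simp add: arc_deriv_unit_circle norm_real_2)
  moreover have "convex_curve unit_circle"
    unfolding convex_curve_def
  \<comment> \<open>The normal at a point of the circle is the point itself; the inequality is
    Cauchy-Schwarz.\<close>
  proof (intro ballI exI conjI)
    fix x y :: complex assume x: "x \<in> sphere 0 1" and y: "y \<in> sphere 0 1"
    have n: "norm (unit_circle w) = 1" if "w \<in> sphere 0 1" for w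
      using that by (simp add: unit_circle_def norm_real_2 cmod_def)
    then show "norm (unit_circle x) = 1" using x by simp
    have "unit_circle x \<bullet> unit_circle y \<le> 1"
      using norm_cauchy_schwarz[of "unit_circle x" "unit_circle y"] n x y by simp
    moreover have "unit_circle x \<bullet> unit_circle x = 1"
      using n[OF x] by (simp add: norm_eq_1)
    ultimately show "0 \<le> unit_circle x \<bullet> (unit_circle x - unit_circle y)"
      by (simp add: inner_diff_right)
  qed
  ultimately show ?thesis unfolding X_def by blast
qed

text \<open>The numerator is half the squared chord length, so the integrand depends on
  \<open>y - x\<close> only, and a periodic shift removes \<open>x\<close>.\<close>

lemma nonlocal_curvature_unit_circle:
  assumes "x \<in> {0..2*pi}"
  shows "e2ennreal \<bar>nonlocal_curvature s unit_circle x\<bar> = circle_curvature s"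
proof -
  \<comment> \<open>\<open>2 * sin (t / 2)\<close> changes sign after \<open>2 * pi\<close>; the
    absolute value makes \<open>h\<close> periodic and covers negative \<open>y - x\<close>.\<close>
  define h where "h = (\<lambda>t. \<bar>2 * sin (t / 2)\<bar> powr - s / 2)"
  have [measurable]: "h \<in> borel_measurable borel" unfolding h_def by measurable
  have integrand: "(perp (arc_deriv unit_circle y) \<bullet> (lift unit_circle y - lift unit_circle x))
      / norm (lift unit_circle y - lift unit_circle x) powr (2 + s) * norm (arc_deriv unit_circle y) = h (y - x)" for y
  proof -
    let ?r = "norm (lift unit_circle y - lift unit_circle x)"
    have "(cos y - cos x)\<^sup>2 + (sin y - sin x)\<^sup>2
        = ((cos y)\<^sup>2 + (sin y)\<^sup>2) + ((cos x)\<^sup>2 + (sin x)\<^sup>2) - 2 * (cos y * cos x + sin y * sin x)"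
      by (simp add: power2_eq_square algebra_simps)
    also have "\<dots> = 2 * (1 - cos (y - x))" by (simp add: cos_diff algebra_simps)
    finally have r2: "?r\<^sup>2 = 2 * (1 - cos (y - x))"
      by (simp add: norm_real_2 lift_unit_circle)
    also have "\<dots> = (2 * sin ((y - x) / 2))\<^sup>2"
    proof -
      have "cos (y - x) = cos (2 * ((y - x) / 2))" by (simp only: nonzero_mult_div_cancel_left times_divide_eq_right)
      also have "\<dots> = 1 - 2 * (sin ((y - x) / 2))\<^sup>2" by (rule cos_double_sin)
      finally show ?thesis by (simp add: power_mult_distrib)
    qed
    finally have r: "?r = \<bar>2 * sin ((y - x) / 2)\<bar>"
      by (metis abs_norm_cancel power2_eq_iff_nonneg abs_ge_zero norm_ge_zero power2_abs)
    have "perp (arc_deriv unit_circle y) \<bullet> (lift unit_circle y - lift unit_circle x)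
        = ((cos y)\<^sup>2 + (sin y)\<^sup>2) - (cos y * cos x + sin y * sin x)"
      by (simp add: perp_def arc_deriv_unit_circle inner_real_2 lift_unit_circle power2_eq_square algebra_simps)
    also have "\<dots> = ?r\<^sup>2 / 2" by (simp add: r2 cos_diff)
    finally have num: "perp (arc_deriv unit_circle y) \<bullet> (lift unit_circle y - lift unit_circle x) = ?r\<^sup>2 / 2" .
    \<comment> \<open>On the diagonal both sides are zero, since \<open>0 powr - s\<close> is zero
      by convention.\<close>
    have "?r\<^sup>2 / 2 / ?r powr (2 + s) = ?r powr - s / 2"
    proof (cases "?r = 0")
      case False
      then have "?r powr (2 + s) = ?r\<^sup>2 * ?r powr s" by (simp add: powr_add)
      then show ?thesis using False by (simp add: powr_minus_divide)
    qed simp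
    moreover have "norm (arc_deriv unit_circle y) = 1"
      by (simp add: arc_deriv_unit_circle norm_real_2)
    ultimately show ?thesis by (simp add: num r h_def)
  qed
  have h_nonneg: "0 \<le> h t" for t by (simp add: h_def)
  have "nonlocal_curvature s unit_circle x = ext_integral arc_measure (\<lambda>y. h (y - x))"
    unfolding nonlocal_curvature_def integrand ..
  then have "e2ennreal \<bar>nonlocal_curvature s unit_circle x\<bar> = (\<integral>\<^sup>+y. ennreal (h (y - x)) \<partial>arc_measure)"
    using h_nonneg by (simp add: ext_integral_def ennreal_neg zero_ennreal.rep_eq)
  also have "\<dots> = (\<integral>\<^sup>+y. ennreal (h (y - x)) * indicator {0..2*pi} y \<partial>lborel)"
    by (rule nn_integral_arc_measure)
  also have "\<dots> = (\<integral>\<^sup>+y. ennreal (h y) * indicator {0..2*pi} y \<partial>lborel)"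
  proof -
    have "h (t + 2 * pi) = h t" for t by (simp add: h_def add_divide_distrib)
    then have "h (y + 2 * pi - x) = h (y - x)" for y
      by (metis add_diff_eq add.commute diff_add_eq)
    then show ?thesis
      using nn_integral_periodic_shift[of "\<lambda>y. ennreal (h (y - x))" "2*pi" x] assms by simp
  qed
  also have "\<dots> = circle_curvature s"
    unfolding circle_curvature_def h_def
    by (intro nn_integral_cong) (auto simp: indicator_def sin_ge_zero)
  finally show ?thesis .
qed

lemma W_unit_circle: "W s unit_circle = ennreal (2 * pi) * enn_powr (circle_curvature s) (1 / s)"
proof -
  have "W s unit_circle = (\<integral>\<^sup>+x. enn_powr (circle_curvature s) (1 / s) \<partial>arc_measure)"
    unfolding W_def
    by (intro nn_integral_cong)
      (auto simp: arc_measure_def space_restrict_space nonlocal_curvature_unit_circle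
        arc_deriv_unit_circle norm_real_2)
  then show ?thesis by (simp add: emeasure_arc_measure mult.commute)
qed

theorem theorem1p1:
  fixes s :: real
  assumes "0 < s" and "s < 1"
  shows "\<exists>\<gamma>\<in>X. \<forall>\<eta>\<in>X. W s \<gamma> \<le> W s \<eta>"
proof (intro bexI ballI)
  show "W s unit_circle \<le> W s \<eta>" if "\<eta> \<in> X" for \<eta>
    using W_ge_circle[OF that assms] by (simp add: W_unit_circle)
qed (rule unit_circle_in_X)

end
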